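(* Let $0<\alpha<1$, let $\Omega=(a,b)$, let $\kappa$ satisfy $c_0\le\kappa\le c_1$ on $\Omega$ for some positive constants $c_0,c_1$, and let $u$ satisfy $-\partial_x\big(\kappa\,{}_aD_x^{\alpha}u\big)=f$ on $\Omega$ with $u(a)=u(b)=0$. Assume that $f\in C^1(\overline\Omega)$, $\kappa\in C^2(\overline\Omega)$ and $u\in C^3(\overline\Omega)$. Then the truncation error $$T_h^n=\partial_x\big(\kappa\,{}_aD_x^{\alpha}u\big)(x_n)-\frac1{h^2}\Big[\kappa^{n+1/2}\big({}_aI_x^{1-\alpha}\delta u\big)(x_{n+1})-\kappa^{n-1/2}\big({}_aI_x^{1-\alpha}\delta u\big)(x_n)\Big]$$ satisfies $$T_h^n=O(h)\,\big(1+(x_n-a)^{-\alpha}\big),\qquad 1\le n\le P-1.$$ That is, the truncation error is of order $h$ for $x_n$ not too close to the left boundary.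
   Context: Uniform mesh: $P\ge 2$ is an integer, $h=(b-a)/P$, $x_n=a+nh$ for $0\le n\le P$, $I_n=(x_{n-1},x_n)$, $x_{n+1/2}=(x_n+x_{n+1})/2$, $\kappa^{n+1/2}=\kappa(x_{n+1/2})$, $u^n=u(x_n)$. The backward difference $\delta u$ is the piecewise constant function $\delta u(x)=\delta u^n:=u^n-u^{n-1}$ for $x\in I_n$. The left-sided Riemann–Liouville fractional integral and derivative are ${}_aI_x^{1-\alpha}v(x)=\int_a^x\omega_{1-\alpha}(x-z)v(z)\,dz$ and ${}_aD_x^{\alpha}v(x)=\partial_x\,{}_aI_x^{1-\alpha}v(x)$, with $\omega_{1-\alpha}(x)=x^{-\alpha}/\Gamma(1-\alpha)$. In the $O(h)$ term the implied constant may depend on $\alpha,a,b,\kappa,u,f$ but not on $n$ or $h$. *)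

theory Defs
  imports "HOL-Analysis.Analysis"
begin

text \<open>Membership in \<open>C\<^sup>k(S)\<close> for a closed interval \<open>S\<close>: \<open>D j\<close> is the \<open>j\<close>-th derivative, which is
  one-sided at the endpoints. Only the values of \<open>f\<close> on \<open>S\<close> matter.\<close>

definition Ck_on :: "nat \<Rightarrow> (real \<Rightarrow> real) \<Rightarrow> real set \<Rightarrow> bool" where
  "Ck_on k f S \<longleftrightarrow> (\<exists>D :: nat \<Rightarrow> real \<Rightarrow> real.
     (\<forall>x\<in>S. D 0 x = f x) \<and>
     (\<forall>j<k. \<forall>x\<in>S. (D j has_real_derivative D (Suc j) x) (at x within S)) \<and>
     (\<forall>j\<le>k. continuous_on S (D j)))"

definition frac_kernel :: "real \<Rightarrow> real \<Rightarrow> real" where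
  "frac_kernel \<beta> x = x powr (\<beta> - 1) / Gamma \<beta>"

definition RL_integral :: "real \<Rightarrow> real \<Rightarrow> (real \<Rightarrow> real) \<Rightarrow> real \<Rightarrow> real" where
  "RL_integral a \<beta> v x = integral {a..x} (\<lambda>z. frac_kernel \<beta> (x - z) * v z)"

definition RL_derivative :: "real \<Rightarrow> real \<Rightarrow> (real \<Rightarrow> real) \<Rightarrow> real \<Rightarrow> real" where
  "RL_derivative a \<alpha> v x = deriv (RL_integral a (1 - \<alpha>) v) x"

definition mesh_size :: "real \<Rightarrow> real \<Rightarrow> nat \<Rightarrow> real" where
  "mesh_size a b P = (b - a) / real P"

definition mesh_node :: "real \<Rightarrow> real \<Rightarrow> nat \<Rightarrow> nat \<Rightarrow> real" where
  "mesh_node a b P n = a + real n * mesh_size a b P"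

text \<open>\<open>mesh_mid a b P n\<close> is \<open>x\<^bsub>n+1/2\<^esub>\<close>, so \<open>x\<^bsub>n-1/2\<^esub>\<close> is \<open>mesh_mid a b P (n - 1)\<close> for \<open>n \<ge> 1\<close>.\<close>

definition mesh_mid :: "real \<Rightarrow> real \<Rightarrow> nat \<Rightarrow> nat \<Rightarrow> real" where
  "mesh_mid a b P n = midpoint (mesh_node a b P n) (mesh_node a b P (Suc n))"

text \<open>The intervals \<open>I\<^sub>n\<close> are open and disjoint, so at most one summand is nonzero. The value at
  the mesh nodes (here \<open>0\<close>) is immaterial under the integral.\<close>

definition backward_diff ::
    "real \<Rightarrow> real \<Rightarrow> nat \<Rightarrow> (real \<Rightarrow> real) \<Rightarrow> real \<Rightarrow> real" where
  "backward_diff a b P u x =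
     (\<Sum>n=1..P. (u (mesh_node a b P n) - u (mesh_node a b P (n - 1))) *
        indicator {mesh_node a b P (n - 1)<..<mesh_node a b P n} x)"

definition truncation_error ::
    "real \<Rightarrow> real \<Rightarrow> real \<Rightarrow> (real \<Rightarrow> real) \<Rightarrow> (real \<Rightarrow> real) \<Rightarrow> nat \<Rightarrow> nat \<Rightarrow> real" where
  "truncation_error \<alpha> a b \<kappa> u P n =
     deriv (\<lambda>x. \<kappa> x * RL_derivative a \<alpha> u x) (mesh_node a b P n) -
     1 / (mesh_size a b P)\<^sup>2 *
       (\<kappa> (mesh_mid a b P n) *
          RL_integral a (1 - \<alpha>) (backward_diff a b P u) (mesh_node a b P (n + 1)) -
        \<kappa> (mesh_mid a b P (n - 1)) *
          RL_integral a (1 - \<alpha>) (backward_diff a b P u) (mesh_node a b P n))"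

end

theory Submission
  imports Defs
begin

text \<open>
  Write \<open>\<beta> = 1 - \<alpha>\<close>, let \<open>g\<close> be the fractional derivative of \<open>u\<close> and \<open>S m\<close> the fractional integral of
  \<open>\<delta>u\<close> at \<open>x\<^sub>m\<close>. Since \<open>u a = 0\<close>, the function \<open>g\<close> is the fractional integral of \<open>u'\<close> of order \<open>\<beta>\<close>, and
  its derivative is \<open>frac_kernel \<beta> (x - a) * u'(a)\<close> plus the fractional integral of \<open>u''\<close>
  (\<open>RL_integral_has_derivative\<close>).

  The first point is that \<open>u'(a) = 0\<close>. The equation makes the derivative of \<open>\<kappa> g\<close> equal to the bounded
  function \<open>- f\<close>, whereas \<open>u'(a) \<noteq> 0\<close> would make it blow up at \<open>a\<close> (\<open>initial_slope_zero\<close>).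

  The second point is that \<open>\<delta>u\<close> is a step function, so that \<open>S m\<close> is a discrete convolution of the
  differences of \<open>u\<close> with exact masses of the kernel, where the masses depend only on the distance to the
  node. Hence \<open>S (n + 1) - S n\<close> is the same convolution applied to second differences, plus a contribution
  of the first cell. Comparing difference quotients with derivatives cell by cell gives
  \<open>S n / h = g(x\<^sub>n) + O(h)\<close> (\<open>RL_difference_sum_error\<close>) and
  \<open>(S (n + 1) - S n) / h\<^sup>2 = g'(x\<^sub>n) + O(h) (1 + (x\<^sub>n - a)\<^sup>-\<^sup>\<alpha>)\<close> (\<open>RL_difference_sum_increment_error\<close>). In
  the latter, the singular factor is the mass of the kernel on the first cell divided by \<open>h\<close>, and it is
  multiplied by \<open>\<delta>u\<^sup>1 / h\<close>, which is \<open>O(h)\<close> because \<open>u'(a) = 0\<close>.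

  Finally, a discrete product rule (\<open>flux_difference_decomposition\<close>) splits the truncation error into
  these two errors, the shift of \<open>\<kappa>\<close> by \<open>h / 2\<close> and the central difference error of \<open>\<kappa>\<close>, each multiplied by
  a bounded quantity.
\<close>

section \<open>The kernel of fractional integration\<close>

lemma Gamma_real_nonzero [simp]: "(x::real) > 0 \<Longrightarrow> Gamma x \<noteq> 0"
  using Gamma_real_pos[of x] by linarith

lemma frac_kernel_nonneg: "\<beta> > 0 \<Longrightarrow> 0 \<le> frac_kernel \<beta> x"
  by (simp add: frac_kernel_def Gamma_real_pos less_imp_le)

lemma frac_kernel_0 [simp]: "frac_kernel \<beta> 0 = 0"
  by (simp add: frac_kernel_def)

text \<open>The kernels form a chain of antiderivatives: raising the order by one integrates once. Hence
  \<open>frac_kernel (\<beta> + 1)\<close> gives the integral of the weakly singular kernel of order \<open>\<beta>\<close> over any cell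
  in closed form, which is how every such integral below is evaluated.\<close>

lemma frac_kernel_has_derivative:
  assumes "\<beta> > 0" "x > 0"
  shows "(frac_kernel (\<beta> + 1) has_real_derivative frac_kernel \<beta> x) (at x)"
proof -
  have G: "Gamma (\<beta> + 1) = \<beta> * Gamma \<beta>"
    using assms by (intro Gamma_plus1) (auto elim!: nonpos_Ints_cases)
  have "((\<lambda>x. x powr \<beta> / Gamma (\<beta> + 1)) has_real_derivative
          \<beta> * x powr (\<beta> - 1) / Gamma (\<beta> + 1)) (at x)"
    using assms by (auto intro!: derivative_eq_intros)
  moreover have "\<beta> * x powr (\<beta> - 1) / Gamma (\<beta> + 1) = frac_kernel \<beta> x"
    using assms by (simp add: G frac_kernel_def)
  ultimately show ?thesis
    unfolding frac_kernel_def [abs_def] by simp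
qed

lemma continuous_on_frac_kernel:
  assumes "\<beta> > 0"
  shows "continuous_on {0..} (frac_kernel (\<beta> + 1))"
  unfolding frac_kernel_def using assms Gamma_real_pos[of "\<beta>+1"]
  by (auto intro!: continuous_intros continuous_on_powr')

lemma frac_kernel_mono:
  assumes "\<beta> > 0" "0 \<le> x" "x \<le> y"
  shows "frac_kernel (\<beta> + 1) x \<le> frac_kernel (\<beta> + 1) y"
  unfolding frac_kernel_def using assms Gamma_real_pos[of "\<beta>+1"]
  by (intro divide_right_mono powr_mono2) auto

lemma frac_kernel_has_integral:
  assumes "\<beta> > 0" "p \<le> q" "q \<le> x"
  shows "((\<lambda>z. frac_kernel \<beta> (x - z)) has_integral
           frac_kernel (\<beta> + 1) (x - p) - frac_kernel (\<beta> + 1) (x - q)) {p..q}"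
proof -
  have "continuous_on {p..q} (\<lambda>z. x - z)"
    by (intro continuous_intros)
  then have cont: "continuous_on {p..q} (\<lambda>z. - frac_kernel (\<beta> + 1) (x - z))"
    by (intro continuous_on_minus continuous_on_compose2[OF continuous_on_frac_kernel[OF \<open>\<beta> > 0\<close>]])
      (use assms in auto)
  have deriv: "((\<lambda>z. - frac_kernel (\<beta> + 1) (x - z)) has_vector_derivative frac_kernel \<beta> (x - z)) (at z)"
    if "z \<in> {p<..<q}" for z
  proof -
    have "((\<lambda>z. x - z) has_real_derivative - 1) (at z)"
      by (auto intro!: derivative_eq_intros)
    from DERIV_minus[OF DERIV_chain2[OF frac_kernel_has_derivative[OF \<open>\<beta> > 0\<close>] this]]
    show ?thesis
      using that assms by (simp add: has_real_derivative_iff_has_vector_derivative)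
  qed
  from fundamental_theorem_of_calculus_interior[OF \<open>p \<le> q\<close> cont deriv]
  show ?thesis by simp
qed

text \<open>For \<open>\<beta> < 1\<close> the kernel blows up at \<open>0\<close>, so no nonzero multiple of it stays bounded there.
  This is what turns boundedness of the source term into a condition on \<open>u'(a)\<close>.\<close>

lemma frac_kernel_unbounded:
  assumes "0 < \<beta>" "\<beta> < 1" "d > 0"
    and bound: "\<And>t. 0 < t \<Longrightarrow> t < d \<Longrightarrow> \<bar>y\<bar> * frac_kernel \<beta> t \<le> B"
  shows "y = 0"
proof -
  have "((\<lambda>t. (B * Gamma \<beta>) * t powr (1 - \<beta>)) \<longlongrightarrow> (B * Gamma \<beta>) * 0) (at_right 0)"
    using assms(2) by (intro tendsto_mult_left tendsto_zero_powrI[where b = "1 - \<beta>"])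
      (auto simp: eventually_at_right[OF zero_less_one] intro: exI[of _ 1])
  moreover have "\<forall>\<^sub>F t in at_right 0. \<bar>y\<bar> \<le> (B * Gamma \<beta>) * t powr (1 - \<beta>)"
    unfolding eventually_at_right[OF zero_less_one]
  proof (intro exI[of _ d] conjI allI impI)
    fix t :: real assume t: "0 < t" "t < d"
    have "\<bar>y\<bar> = (\<bar>y\<bar> * frac_kernel \<beta> t) * Gamma \<beta> * t powr (1 - \<beta>)"
      using t assms(1) by (simp add: frac_kernel_def flip: powr_add)
    also have "\<dots> \<le> B * Gamma \<beta> * t powr (1 - \<beta>)"
      using t Gamma_real_pos[OF assms(1)] by (intro mult_right_mono bound) auto
    finally show "\<bar>y\<bar> \<le> B * Gamma \<beta> * t powr (1 - \<beta>)" .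
  qed (use assms in auto)
  ultimately have "\<bar>y\<bar> \<le> B * Gamma \<beta> * 0"
    by (intro tendsto_lowerbound) auto
  then show ?thesis by simp
qed

section \<open>Differentiating fractional integrals\<close>

text \<open>Integration by parts trades the singular kernel for its bounded antiderivative. The boundary
  term at \<open>z = x\<close> vanishes because that antiderivative is \<open>0\<close> there. Besides the value, this supplies
  integrability of the singular integrand.\<close>

lemma RL_by_parts:
  assumes "\<beta> > 0" "a \<le> x"
    and v: "\<And>z. z \<in> {a..x} \<Longrightarrow> (v has_real_derivative v' z) (at z within {a..x})"
    and v': "continuous_on {a..x} v'"
  shows "((\<lambda>z. frac_kernel \<beta> (x - z) * v z) has_integral
           frac_kernel (\<beta> + 1) (x - a) * v a + RL_integral a (\<beta> + 1) v' x) {a..x}"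
proof -
  have cont: "continuous_on {a..x} (\<lambda>z. frac_kernel (\<beta> + 1) (x - z))"
    by (rule continuous_on_compose2[OF continuous_on_frac_kernel[OF \<open>\<beta> > 0\<close>]])
      (auto intro!: continuous_intros)
  have "((\<lambda>z. (- frac_kernel (\<beta> + 1) (x - z)) * v' z) has_integral
          - RL_integral a (\<beta> + 1) v' x) {a..x}"
    unfolding RL_integral_def
    using has_integral_neg[OF integrable_integral[OF integrable_continuous_interval
        [OF continuous_on_mult[OF cont v']]]]
    by simp
  then show ?thesis
  proof (intro integration_by_parts_interior[where f = "\<lambda>z. - frac_kernel (\<beta> + 1) (x - z)"
      and g = v and f' = "\<lambda>z. frac_kernel \<beta> (x - z)" and g' = v',
      OF bounded_bilinear_mult \<open>a \<le> x\<close>])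
    show "continuous_on {a..x} (\<lambda>z. - frac_kernel (\<beta> + 1) (x - z))"
      using cont by (intro continuous_intros)
    show "continuous_on {a..x} v"
      by (rule DERIV_continuous_on[OF v])
    fix z assume z: "z \<in> {a<..<x}"
    have "((\<lambda>z. frac_kernel (\<beta> + 1) (x - z)) has_real_derivative frac_kernel \<beta> (x - z) * (- 1)) (at z)"
      by (rule DERIV_chain'[where f="\<lambda>z. x - z", OF _ frac_kernel_has_derivative])
        (use z assms(1) in \<open>auto intro!: derivative_eq_intros\<close>)
    from DERIV_minus[OF this]
    show "((\<lambda>z. - frac_kernel (\<beta> + 1) (x - z)) has_vector_derivative frac_kernel \<beta> (x - z)) (at z)"
      by (simp add: has_real_derivative_iff_has_vector_derivative)
    show "(v has_vector_derivative v' z) (at z)"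
      using v[of z] z at_within_Icc_at[of a z x]
      by (simp add: has_real_derivative_iff_has_vector_derivative)
  qed simp
qed

text \<open>Extending the kernel by zero to the negative axis turns an integral over \<open>[a, x]\<close> into one over
  the fixed interval \<open>[a, b]\<close>. For \<open>\<gamma> > 1\<close> the kernel of order \<open>\<gamma> + 1\<close> vanishes at \<open>0\<close> to an order
  above one, so the extension remains differentiable across the kink.\<close>

lemma has_derivative_positive_part_frac_kernel:
  assumes "\<gamma> > 1"
  shows "((\<lambda>t. frac_kernel (\<gamma> + 1) (max t 0)) has_real_derivative frac_kernel \<gamma> (max t 0)) (at t)"
proof (cases t "0::real" rule: linorder_cases)
  case less
  have "((\<lambda>t. 0::real) has_real_derivative frac_kernel \<gamma> (max t 0)) (at t)"
    using less by simp
  then show ?thesis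
    by (rule has_field_derivative_transform_within_open[of _ _ _ "{..<0}"]) (use less in auto)
next
  case equal
  have G: "Gamma (\<gamma> + 1) > 0"
    using assms by (intro Gamma_real_pos) simp
  have "((\<lambda>s. frac_kernel (\<gamma> + 1) (max s 0) / s) \<longlongrightarrow> 0) (at 0)"
  proof (rule Lim_null_comparison)
    have "continuous_on UNIV (\<lambda>s::real. \<bar>s\<bar> powr (\<gamma> - 1) / Gamma (\<gamma> + 1))"
      using assms G by (intro continuous_on_divide continuous_on_powr' continuous_intros) auto
    then have "isCont (\<lambda>s::real. \<bar>s\<bar> powr (\<gamma> - 1) / Gamma (\<gamma> + 1)) 0"
      by (simp add: continuous_on_eq_continuous_at)
    then show "((\<lambda>s::real. \<bar>s\<bar> powr (\<gamma> - 1) / Gamma (\<gamma> + 1)) \<longlongrightarrow> 0) (at 0)"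
      using assms by (simp add: isCont_def)
    have "norm (frac_kernel (\<gamma> + 1) (max s 0) / s) \<le> \<bar>s\<bar> powr (\<gamma> - 1) / Gamma (\<gamma> + 1)" for s :: real
    proof (cases "s > 0")
      case True
      then show ?thesis
        using assms by (simp add: frac_kernel_def powr_diff mult.commute)
    next
      case False
      then show ?thesis
        using G by (auto simp: max_def)
    qed
    then show "\<forall>\<^sub>F s in at 0. norm (frac_kernel (\<gamma> + 1) (max s 0) / s)
                 \<le> \<bar>s\<bar> powr (\<gamma> - 1) / Gamma (\<gamma> + 1)"
      by simp
  qed
  then show ?thesis
    using equal by (simp add: has_field_derivative_iff)
next
  case greater
  have "(frac_kernel (\<gamma> + 1) has_real_derivative frac_kernel \<gamma> (max t 0)) (at t)"
    using greater assms frac_kernel_has_derivative[of \<gamma> t] by simp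
  then show ?thesis
    by (rule has_field_derivative_transform_within_open[of _ _ _ "{0<..}"]) (use greater in auto)
qed

lemma continuous_on_positive_part_frac_kernel:
  assumes "\<gamma> > 1"
  shows "continuous_on UNIV (\<lambda>t. frac_kernel \<gamma> (max t 0))"
proof (rule continuous_on_compose2[where g = "frac_kernel \<gamma>" and t = "{0..}"])
  show "continuous_on {0..} (frac_kernel \<gamma>)"
    using continuous_on_frac_kernel[of "\<gamma> - 1"] assms by simp
  show "continuous_on UNIV (\<lambda>t::real. max t 0)"
    by (intro continuous_intros)
qed auto

lemma RL_integral_eq_positive_part:
  assumes "x \<in> {a..b}"
  shows "RL_integral a \<gamma> w x = integral {a..b} (\<lambda>z. frac_kernel \<gamma> (max (x - z) 0) * w z)"
proof -
  have "RL_integral a \<gamma> w x =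
      integral {a..b} (\<lambda>z. if z \<in> {a..x} then frac_kernel \<gamma> (x - z) * w z else 0)"
    unfolding RL_integral_def using assms
    by (subst Henstock_Kurzweil_Integration.integral_restrict_Int) (auto simp: Int_absorb2)
  also have "\<dots> = integral {a..b} (\<lambda>z. frac_kernel \<gamma> (max (x - z) 0) * w z)"
    by (intro integral_cong) (auto simp: max_def)
  finally show ?thesis .
qed

text \<open>With the extended kernel, the Leibniz rule for fixed limits applies. It
  asks for joint continuity of the differentiated kernel, that is, of the extended kernel of order \<open>\<gamma>\<close>,
  whence \<open>\<gamma> > 1\<close>.\<close>

lemma RL_integral_has_derivative_smooth:
  assumes "\<gamma> > 1" and w: "continuous_on {a..b} w" and x: "x \<in> {a<..<b}"
  shows "(RL_integral a (\<gamma> + 1) w has_real_derivative RL_integral a \<gamma> w x) (at x)"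
proof -
  note contK = continuous_on_positive_part_frac_kernel[OF \<open>\<gamma> > 1\<close>]
  have contK1: "continuous_on UNIV (\<lambda>t. frac_kernel (\<gamma> + 1) (max t 0))"
    using continuous_on_positive_part_frac_kernel[of "\<gamma> + 1"] assms(1) by simp
  have dK: "((\<lambda>y. frac_kernel (\<gamma> + 1) (max (y - z) 0)) has_real_derivative
      frac_kernel \<gamma> (max (y - z) 0)) (at y)" for y z
  proof -
    have "((\<lambda>y. y - z) has_real_derivative 1) (at y)"
      by (auto intro!: derivative_eq_intros)
    from DERIV_chain2[OF has_derivative_positive_part_frac_kernel[OF \<open>\<gamma> > 1\<close>] this]
    show ?thesis by simp
  qed
  have "((\<lambda>y. integral (cbox a b) (\<lambda>z. frac_kernel (\<gamma> + 1) (max (y - z) 0) * w z))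
      has_field_derivative integral (cbox a b) (\<lambda>z. frac_kernel \<gamma> (max (x - z) 0) * w z))
      (at x within {a<..<b})"
  proof (rule leibniz_rule_field_derivative[where U = "{a<..<b}"])
    fix y z
    show "((\<lambda>y. frac_kernel (\<gamma> + 1) (max (y - z) 0) * w z) has_real_derivative
           frac_kernel \<gamma> (max (y - z) 0) * w z) (at y within {a<..<b})"
      by (rule has_field_derivative_at_within[OF DERIV_cmult_right[OF dK]])
  next
    fix y
    have "continuous_on {a..b} (\<lambda>z. y - z)"
      by (intro continuous_intros)
    from continuous_on_mult[OF continuous_on_compose2[OF contK1 this] w]
    show "(\<lambda>z. frac_kernel (\<gamma> + 1) (max (y - z) 0) * w z) integrable_on cbox a b"
      using integrable_continuous_interval by simp
  next
    have c1: "continuous_on ({a<..<b} \<times> {a..b}) (\<lambda>p. fst p - snd p :: real)"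
      by (intro continuous_intros)
    have c2: "continuous_on ({a<..<b} \<times> {a..b}) (\<lambda>p. w (snd p))"
      by (rule continuous_on_compose2[OF w continuous_on_snd[OF continuous_on_id]]) auto
    show "continuous_on ({a<..<b} \<times> cbox a b) (\<lambda>(y, z). frac_kernel \<gamma> (max (y - z) 0) * w z)"
      using continuous_on_mult[OF continuous_on_compose2[OF contK c1] c2]
      by (simp add: case_prod_unfold)
  qed (use x in auto)
  then have "((\<lambda>y. integral {a..b} (\<lambda>z. frac_kernel (\<gamma> + 1) (max (y - z) 0) * w z))
      has_real_derivative RL_integral a \<gamma> w x) (at x)"
    using x by (simp add: at_within_open[of x "{a<..<b}"] RL_integral_eq_positive_part[of x a b])
  then show ?thesis
    by (rule has_field_derivative_transform_within_open[of _ _ _ "{a<..<b}"])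
      (use x in \<open>auto simp: RL_integral_eq_positive_part[of _ a b]\<close>)
qed

text \<open>The kernel of order \<open>\<beta>\<close> is too singular for differentiation under the integral sign. Two
  integrations by parts raise the order to \<open>\<beta> + 2\<close>, where this is allowed, and one integration by
  parts in the opposite direction brings the result back. The term \<open>frac_kernel \<beta> (x - a) * v a\<close> is the
  difference between the Riemann-Liouville and the Caputo derivative.\<close>

lemma RL_integral_has_derivative:
  assumes "\<beta> > 0" and x: "x \<in> {a<..<b}"
    and v: "\<And>z. z \<in> {a..b} \<Longrightarrow> (v has_real_derivative v' z) (at z within {a..b})"
    and v': "\<And>z. z \<in> {a..b} \<Longrightarrow> (v' has_real_derivative v'' z) (at z within {a..b})"
    and v'': "continuous_on {a..b} v''"
  shows "(RL_integral a \<beta> v has_real_derivative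
           frac_kernel \<beta> (x - a) * v a + RL_integral a \<beta> v' x) (at x)"
proof -
  have cont: "continuous_on {a..b} v'"
    by (rule DERIV_continuous_on[OF v'])
  have sub: "continuous_on {a..y} v'" "continuous_on {a..y} v''"
    "\<And>z. z \<in> {a..y} \<Longrightarrow> (v has_real_derivative v' z) (at z within {a..y})"
    "\<And>z. z \<in> {a..y} \<Longrightarrow> (v' has_real_derivative v'' z) (at z within {a..y})"
    if "y \<in> {a<..<b}" for y
  proof -
    have y: "{a..y} \<subseteq> {a..b}" using that by auto
    show "continuous_on {a..y} v'" "continuous_on {a..y} v''"
      by (rule continuous_on_subset[OF cont y], rule continuous_on_subset[OF v'' y])
    fix z assume "z \<in> {a..y}"
    then have z: "z \<in> {a..b}" using y by auto
    show "(v has_real_derivative v' z) (at z within {a..y})"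
      "(v' has_real_derivative v'' z) (at z within {a..y})"
      by (rule has_field_derivative_subset[OF v[OF z] y], rule has_field_derivative_subset[OF v'[OF z] y])
  qed
  have parts: "RL_integral a \<gamma> v y = frac_kernel (\<gamma> + 1) (y - a) * v a + RL_integral a (\<gamma> + 1) v' y"
    "RL_integral a \<gamma> v' y = frac_kernel (\<gamma> + 1) (y - a) * v' a + RL_integral a (\<gamma> + 1) v'' y"
    if "y \<in> {a<..<b}" "\<gamma> > 0" for y \<gamma>
    using integral_unique[OF RL_by_parts[OF that(2) _ sub(3)[OF that(1)] sub(1)[OF that(1)]]]
      integral_unique[OF RL_by_parts[OF that(2) _ sub(4)[OF that(1)] sub(2)[OF that(1)]]] that(1)
    unfolding RL_integral_def[of a \<gamma>] by auto
  \<comment> \<open>The fractional integral of \<open>v\<close> after two integrations by parts.\<close>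
  define F where "F y = frac_kernel (\<beta> + 1) (y - a) * v a
      + (frac_kernel (\<beta> + 1 + 1) (y - a) * v' a + RL_integral a (\<beta> + 1 + 1) v'' y)" for y
  have shift: "((\<lambda>y. frac_kernel (\<gamma> + 1) (y - a)) has_real_derivative frac_kernel \<gamma> (x - a)) (at x)"
    if "\<gamma> > 0" for \<gamma>
  proof -
    have "((\<lambda>y. frac_kernel (\<gamma> + 1) (y - a)) has_real_derivative frac_kernel \<gamma> (x - a) * 1) (at x)"
      by (rule DERIV_chain'[where f="\<lambda>y. y - a", OF _ frac_kernel_has_derivative[OF that]])
        (use x in \<open>auto intro!: derivative_eq_intros\<close>)
    then show ?thesis by simp
  qed
  have "(F has_real_derivative frac_kernel \<beta> (x - a) * v a
      + (frac_kernel (\<beta> + 1) (x - a) * v' a + RL_integral a (\<beta> + 1) v'' x)) (at x)"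
    unfolding F_def using assms(1)
    by (intro DERIV_add[OF DERIV_cmult_right[OF shift] DERIV_add[OF DERIV_cmult_right[OF shift]
          RL_integral_has_derivative_smooth[OF _ v'' x]]]) auto
  also have "frac_kernel (\<beta> + 1) (x - a) * v' a + RL_integral a (\<beta> + 1) v'' x = RL_integral a \<beta> v' x"
    using parts(2)[OF x assms(1)] by simp
  finally show ?thesis
    by (rule has_field_derivative_transform_within_open[of _ _ _ "{a<..<b}"])
      (use x assms(1) in \<open>auto simp: F_def parts\<close>)
qed

lemma RL_integrable:
  assumes "\<beta> > 0" "x \<in> {a..b}"
    and v: "\<And>z. z \<in> {a..b} \<Longrightarrow> (v has_real_derivative v' z) (at z within {a..b})"
    and v': "continuous_on {a..b} v'"
  shows "(\<lambda>z. frac_kernel \<beta> (x - z) * v z) integrable_on {a..x}"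
proof -
  have sub: "{a..x} \<subseteq> {a..b}" and "a \<le> x"
    using assms(2) by auto
  show ?thesis
    by (rule has_integral_integrable[OF RL_by_parts[OF \<open>\<beta> > 0\<close> \<open>a \<le> x\<close>
          has_field_derivative_subset[OF v sub] continuous_on_subset[OF v' sub]]])
      (use sub in auto)
qed

section \<open>Fractional integrals of step functions\<close>

text \<open>On a cell the kernel has a known nonnegative mass, so replacing \<open>v\<close> by a constant costs at most
  the sup-distance times that mass. The open interval in the hypothesis admits step functions with
  arbitrary values at the nodes.\<close>

lemma RL_cell_bound:
  assumes "\<beta> > 0" "p \<le> q" "q \<le> x"
    and int: "(\<lambda>z. frac_kernel \<beta> (x - z) * v z) integrable_on {p..q}"
    and bound: "\<And>z. z \<in> {p<..<q} \<Longrightarrow> \<bar>v z - c\<bar> \<le> M"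
  shows "\<bar>integral {p..q} (\<lambda>z. frac_kernel \<beta> (x - z) * v z)
            - c * (frac_kernel (\<beta> + 1) (x - p) - frac_kernel (\<beta> + 1) (x - q))\<bar>
         \<le> M * (frac_kernel (\<beta> + 1) (x - p) - frac_kernel (\<beta> + 1) (x - q))"
proof -
  define A where "A = frac_kernel (\<beta> + 1) (x - p) - frac_kernel (\<beta> + 1) (x - q)"
  define J where "J = integral {p..q} (\<lambda>z. frac_kernel \<beta> (x - z) * v z)"
  have K: "((\<lambda>z. frac_kernel \<beta> (x - z)) has_integral A) {p..q}"
    unfolding A_def by (rule frac_kernel_has_integral[OF assms(1-3)])
  have "((\<lambda>z. frac_kernel \<beta> (x - z) * v z - c * frac_kernel \<beta> (x - z)) has_integral J - c * A) {p..q}"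
    unfolding J_def by (intro has_integral_diff has_integral_mult_right K integrable_integral int)
  then have 1: "((\<lambda>z. frac_kernel \<beta> (x - z) * v z - c * frac_kernel \<beta> (x - z))
      has_integral J - c * A) {p<..<q}"
    by (simp add: has_integral_Icc_iff_Ioo)
  have 2: "((\<lambda>z. M * frac_kernel \<beta> (x - z)) has_integral M * A) {p<..<q}"
    using has_integral_mult_right[OF K, of M] by (simp add: has_integral_Icc_iff_Ioo)
  have le: "norm (frac_kernel \<beta> (x - z) * v z - c * frac_kernel \<beta> (x - z)) \<le> M * frac_kernel \<beta> (x - z)"
    if "z \<in> {p<..<q}" for z
  proof -
    have "frac_kernel \<beta> (x - z) * v z - c * frac_kernel \<beta> (x - z) = frac_kernel \<beta> (x - z) * (v z - c)"
      by (simp add: algebra_simps)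
    then have "norm (frac_kernel \<beta> (x - z) * v z - c * frac_kernel \<beta> (x - z)) = frac_kernel \<beta> (x - z) * \<bar>v z - c\<bar>"
      using frac_kernel_nonneg[OF assms(1), of "x - z"] by (simp add: abs_mult)
    also have "\<dots> \<le> frac_kernel \<beta> (x - z) * M"
      by (rule mult_left_mono[OF bound[OF that] frac_kernel_nonneg[OF assms(1)]])
    finally show ?thesis by (simp add: mult.commute)
  qed
  have "norm (J - c * A) \<le> M * A"
    using Henstock_Kurzweil_Integration.integral_norm_bound_integral[OF
        has_integral_integrable[OF 1] has_integral_integrable[OF 2] le]
    by (simp only: integral_unique[OF 1] integral_unique[OF 2])
  then show ?thesis
    by (simp add: A_def J_def)
qed

lemma RL_integral_abs_le:
  assumes "\<beta> > 0" "a \<le> x" "(\<lambda>z. frac_kernel \<beta> (x - z) * v z) integrable_on {a..x}"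
    and "\<And>z. z \<in> {a..x} \<Longrightarrow> \<bar>v z\<bar> \<le> M"
  shows "\<bar>RL_integral a \<beta> v x\<bar> \<le> M * frac_kernel (\<beta> + 1) (x - a)"
  using RL_cell_bound[OF assms(1,2) order_refl assms(3), of 0 M] assms(4)
  by (simp add: RL_integral_def)

text \<open>The mass of the kernel of order \<open>\<beta>\<close> on the cell at distance \<open>k * h\<close> from its singularity.\<close>

definition kernel_weight :: "real \<Rightarrow> real \<Rightarrow> nat \<Rightarrow> real" where
  "kernel_weight \<beta> h k = frac_kernel (\<beta> + 1) (real (Suc k) * h) - frac_kernel (\<beta> + 1) (real k * h)"

text \<open>The decreasing kernel lies below its value at the end nearest the singularity. For \<open>k = 0\<close> that
  end is the singularity itself, whence \<open>k > 0\<close>. It is here that the factor \<open>(x\<^sub>n - a)\<^sup>-\<^sup>\<alpha>\<close> of the final estimate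
  originates.\<close>

lemma kernel_weight_le:
  assumes "0 < \<beta>" "\<beta> < 1" "h > 0" "k > 0"
  shows "\<bar>kernel_weight \<beta> h k\<bar> \<le> h * frac_kernel \<beta> (real k * h)"
proof -
  have pos: "0 < real k * h" using assms by simp
  have "\<exists>z. real k * h < z \<and> z < real (Suc k) * h \<and>
      frac_kernel (\<beta> + 1) (real (Suc k) * h) - frac_kernel (\<beta> + 1) (real k * h)
        = (real (Suc k) * h - real k * h) * frac_kernel \<beta> z"
    using assms(1,3) pos by (intro MVT2 frac_kernel_has_derivative) (auto intro: less_le_trans)
  then obtain z where z: "real k * h < z" "kernel_weight \<beta> h k = h * frac_kernel \<beta> z"
    by (auto simp: kernel_weight_def algebra_simps)
  have "frac_kernel \<beta> z \<le> frac_kernel \<beta> (real k * h)"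
    unfolding frac_kernel_def using z(1) pos assms Gamma_real_pos[OF \<open>0 < \<beta>\<close>]
    by (intro divide_right_mono powr_mono2') auto
  then show ?thesis
    using z(2) frac_kernel_nonneg[OF \<open>0 < \<beta>\<close>, of z] \<open>h > 0\<close> by (simp add: abs_mult)
qed

text \<open>The cell errors add up without loss, because the masses of the cells telescope to the total
  mass of the kernel. With \<open>M = 0\<close> this evaluates the fractional integral of a step function
  exactly.\<close>

lemma RL_integral_quadrature:
  assumes "\<beta> > 0" "h > 0"
    and int: "\<And>j. j < m \<Longrightarrow> (\<lambda>z. frac_kernel \<beta> (a + real m * h - z) * v z)
                 integrable_on {a + real j * h..a + real (Suc j) * h}"
    and bound: "\<And>j z. j < m \<Longrightarrow> z \<in> {a + real j * h<..<a + real (Suc j) * h} \<Longrightarrow> \<bar>v z - c j\<bar> \<le> M"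
  shows "\<bar>RL_integral a \<beta> v (a + real m * h) - (\<Sum>j<m. c j * kernel_weight \<beta> h (m - Suc j))\<bar>
          \<le> M * frac_kernel (\<beta> + 1) (real m * h)"
proof -
  define F where "F z = frac_kernel \<beta> (a + real m * h - z) * v z" for z
  define K where "K = frac_kernel (\<beta> + 1)"
  \<comment> \<open>Induction over the cells from the left: the node \<open>a + m * h\<close>, and with it the kernel, stays fixed
    while the interval of integration grows.\<close>
  have "F integrable_on {a..a + real k * h} \<and>
        \<bar>integral {a..a + real k * h} F - (\<Sum>j<k. c j * kernel_weight \<beta> h (m - Suc j))\<bar>
          \<le> M * (K (real m * h) - K (real (m - k) * h))" if "k \<le> m" for k
    using that
  proof (induction k)
    case 0
    then show ?case
      using has_integral_integrable[OF has_integral_refl(2)] by simp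
  next
    case (Suc k)
    let ?p = "a + real k * h" and ?q = "a + real (Suc k) * h"
    let ?S = "\<Sum>j<k. c j * kernel_weight \<beta> h (m - Suc j)"
    have le: "a \<le> ?p" "?p \<le> ?q"
      using \<open>h > 0\<close> by (auto intro!: mult_right_mono)
    have qm: "?q \<le> a + real m * h"
      using \<open>h > 0\<close> Suc.prems by (auto intro!: mult_right_mono)
    have IH: "F integrable_on {a..?p}"
      "\<bar>integral {a..?p} F - ?S\<bar> \<le> M * (K (real m * h) - K (real (m - k) * h))"
      using Suc by auto
    have cell: "F integrable_on {?p..?q}"
      using int[of k] Suc.prems by (simp add: F_def[abs_def])
    have arg: "a + real m * h - ?p = real (m - k) * h" "a + real m * h - ?q = real (m - Suc k) * h"
      using Suc.prems by (auto simp: of_nat_diff algebra_simps)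
    have w: "kernel_weight \<beta> h (m - Suc k) = K (real (m - k) * h) - K (real (m - Suc k) * h)"
      using Suc.prems by (simp add: kernel_weight_def K_def Suc_diff_Suc)
    have km: "k < m" using Suc.prems by simp
    have "\<bar>integral {?p..?q} F - c k * kernel_weight \<beta> h (m - Suc k)\<bar> \<le> M * kernel_weight \<beta> h (m - Suc k)"
      using RL_cell_bound[OF \<open>\<beta> > 0\<close> le(2) qm int[OF km] bound[OF km]]
      by (simp only: arg w K_def F_def[abs_def])
    moreover have "integral {a..?q} F = integral {a..?p} F + integral {?p..?q} F"
      using Henstock_Kurzweil_Integration.integral_combine[OF le Henstock_Kurzweil_Integration.integrable_combine[OF le IH(1) cell]]
      by simp
    ultimately have "\<bar>integral {a..?q} F - (\<Sum>j<Suc k. c j * kernel_weight \<beta> h (m - Suc j))\<bar>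
        \<le> M * (K (real m * h) - K (real (m - k) * h)) + M * kernel_weight \<beta> h (m - Suc k)"
      using IH(2) by simp
    also have "\<dots> = M * (K (real m * h) - K (real (m - Suc k) * h))"
      by (simp add: w algebra_simps)
    finally show ?case
      using Henstock_Kurzweil_Integration.integrable_combine[OF le IH(1) cell] by blast
  qed
  from this[of m] show ?thesis
    by (simp add: RL_integral_def F_def[abs_def] K_def)
qed

lemma RL_integral_backward_diff:
  assumes "\<beta> > 0" "a < b" "P > 0" "m \<le> P"
  shows "RL_integral a \<beta> (backward_diff a b P u) (mesh_node a b P m) =
         (\<Sum>j<m. (u (mesh_node a b P (Suc j)) - u (mesh_node a b P j))
            * kernel_weight \<beta> (mesh_size a b P) (m - Suc j))"
proof -
  define h where "h = mesh_size a b P"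
  define x where "x = mesh_node a b P"
  have h: "h > 0"
    using assms by (simp add: h_def mesh_size_def)
  have x: "x n = a + real n * h" for n
    by (simp add: x_def h_def mesh_node_def)
  have x_le: "x i \<le> x j \<longleftrightarrow> i \<le> j" for i j
    using h by (simp add: x)
  have bd: "backward_diff a b P u z = u (x (Suc j)) - u (x j)"
    if j: "j < m" and z: "z \<in> {x j<..<x (Suc j)}" for j z
  proof -
    \<comment> \<open>The cells are disjoint, so only the summand of the cell containing \<open>z\<close> survives.\<close>
    have "indicator {x (n - 1)<..<x n} z = (if n = Suc j then 1 else (0::real))" if "n \<in> {1..P}" for n
    proof (cases "n = Suc j")
      case False
      then consider "n \<le> j" | "Suc j \<le> n - 1"
        by linarith
      then have "x n \<le> x j \<or> x (Suc j) \<le> x (n - 1)"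
        using x_le by metis
      with False z show ?thesis
        by (auto simp: indicator_def)
    qed (use z in auto)
    then have "backward_diff a b P u z =
        (\<Sum>n=1..P. (u (x n) - u (x (n - 1))) * (if n = Suc j then 1 else 0))"
      unfolding backward_diff_def x_def[symmetric] by (intro sum.cong) auto
    also have "\<dots> = (\<Sum>n=1..P. if n = Suc j then u (x n) - u (x (n - 1)) else 0)"
      by (intro sum.cong) auto
    also have "\<dots> = u (x (Suc j)) - u (x j)"
      using j \<open>m \<le> P\<close> by simp
    finally show ?thesis .
  qed
  have "(\<lambda>z. frac_kernel \<beta> (x m - z) * backward_diff a b P u z) integrable_on {x j..x (Suc j)}"
    if "j < m" for j
  proof -
    have "(\<lambda>z. frac_kernel \<beta> (x m - z)) integrable_on {x j..x (Suc j)}"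
      using that x_le assms(1) by (intro has_integral_integrable[OF frac_kernel_has_integral]) auto
    then have *: "(\<lambda>z. frac_kernel \<beta> (x m - z) * (u (x (Suc j)) - u (x j))) integrable_on {x j..x (Suc j)}"
      by (rule integrable_on_mult_left)
    show ?thesis
      by (rule integrable_spike_finite[OF _ _ *, of "{x j, x (Suc j)}"]) (use bd[OF that] in auto)
  qed
  \<comment> \<open>A step function is its own quadrature, so the error bound holds with \<open>M = 0\<close>.\<close>
  then have "\<bar>RL_integral a \<beta> (backward_diff a b P u) (a + real m * h)
      - (\<Sum>j<m. (u (x (Suc j)) - u (x j)) * kernel_weight \<beta> h (m - Suc j))\<bar>
      \<le> 0 * frac_kernel (\<beta> + 1) (real m * h)"
    by (intro RL_integral_quadrature[OF assms(1) h]) (use bd in \<open>auto simp flip: x simp del: of_nat_Suc\<close>)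
  then show ?thesis
    by (simp flip: x) (simp add: x_def h_def)
qed

section \<open>Difference quotients\<close>

lemma mvt_within:
  fixes f :: "real \<Rightarrow> real"
  assumes "p < q" "{p..q} \<subseteq> S"
    and "\<And>z. z \<in> S \<Longrightarrow> (f has_real_derivative f' z) (at z within S)"
  obtains \<xi> where "\<xi> \<in> {p<..<q}" "f q - f p = (q - p) * f' \<xi>"
proof -
  have "(f has_derivative (*) (f' z)) (at z within {p..q})" if "p \<le> z" "z \<le> q" for z
    using has_field_derivative_subset[OF assms(3) assms(2), of z] that assms(2)
    by (auto simp: has_field_derivative_def)
  from mvt_simple[OF \<open>p < q\<close> this] that show ?thesis
    by (auto simp: mult.commute)
qed

lemma lipschitz_within:
  fixes f :: "real \<Rightarrow> real"
  assumes "\<And>z. z \<in> {a..b} \<Longrightarrow> (f has_real_derivative f' z) (at z within {a..b})"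
    and "\<And>z. z \<in> {a..b} \<Longrightarrow> \<bar>f' z\<bar> \<le> M"
    and "p \<in> {a..b}" "q \<in> {a..b}" "\<bar>p - q\<bar> \<le> d" "0 \<le> M"
  shows "\<bar>f p - f q\<bar> \<le> M * d"
proof -
  have "norm (f p - f q) \<le> M * norm (p - q)"
    using assms by (intro field_differentiable_bound[of "{a..b}" f f']) auto
  also have "\<dots> \<le> M * d"
    using assms by (intro mult_left_mono) auto
  finally show ?thesis by simp
qed

text \<open>Twice the mean value theorem, first for the increment \<open>f (t + h) - f t\<close> and then for \<open>f1\<close>,
  identifies the second difference quotient as a value of \<open>f2\<close> at some point of \<open>{p<..<p + 2 * h}\<close>.
  Centring is of no concern: the estimate is of first order anyway.\<close>

lemma second_difference_bound:
  fixes f :: "real \<Rightarrow> real"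
  assumes d1: "\<And>z. z \<in> {a..b} \<Longrightarrow> (f has_real_derivative f1 z) (at z within {a..b})"
    and d2: "\<And>z. z \<in> {a..b} \<Longrightarrow> (f1 has_real_derivative f2 z) (at z within {a..b})"
    and d3: "\<And>z. z \<in> {a..b} \<Longrightarrow> (f2 has_real_derivative f3 z) (at z within {a..b})"
    and M: "\<And>z. z \<in> {a..b} \<Longrightarrow> \<bar>f3 z\<bar> \<le> M" and "0 \<le> M"
    and "h > 0" "a \<le> p" "p + 2 * h \<le> b" and z: "z \<in> {p<..<p + h}"
  shows "\<bar>f2 z - (f (p + 2 * h) - 2 * f (p + h) + f p) / h\<^sup>2\<bar> \<le> M * (2 * h)"
proof -
  have D: "((\<lambda>t. f (t + h) - f t) has_real_derivative f1 (t + h) - f1 t) (at t within {p..p + h})"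
    if "t \<in> {p..p + h}" for t
  proof (rule DERIV_diff)
    have "((\<lambda>t. t + h) has_real_derivative 1) (at t within {p..p + h})"
      by (auto intro!: derivative_eq_intros)
    moreover have "(f has_real_derivative f1 (t + h)) (at (t + h) within (\<lambda>t. t + h) ` {p..p + h})"
      by (rule has_field_derivative_subset[OF d1]) (use that assms in auto)
    ultimately show "((\<lambda>t. f (t + h)) has_real_derivative f1 (t + h)) (at t within {p..p + h})"
      using DERIV_image_chain[of f "f1 (t + h)" "\<lambda>t. t + h" t "{p..p + h}" 1]
      by (simp add: o_def)
    show "(f has_real_derivative f1 t) (at t within {p..p + h})"
      by (rule has_field_derivative_subset[OF d1]) (use that assms in auto)
  qed
  obtain \<xi> where \<xi>: "\<xi> \<in> {p<..<p + h}"
    "(f (p + h + h) - f (p + h)) - (f (p + h) - f p) = (p + h - p) * (f1 (\<xi> + h) - f1 \<xi>)"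
    using mvt_within[OF _ subset_refl D, of thesis] \<open>h > 0\<close> by auto
  obtain \<eta> where \<eta>: "\<eta> \<in> {\<xi><..<\<xi> + h}" "f1 (\<xi> + h) - f1 \<xi> = (\<xi> + h - \<xi>) * f2 \<eta>"
  proof -
    have "\<xi> < \<xi> + h" "{\<xi>..\<xi> + h} \<subseteq> {a..b}"
      using \<xi>(1) assms by auto
    then show ?thesis
      using mvt_within[OF _ _ d2] that by metis
  qed
  have "f (p + 2 * h) - 2 * f (p + h) + f p = h\<^sup>2 * f2 \<eta>"
    using \<xi>(2) \<eta>(2) by (simp add: power2_eq_square algebra_simps)
  then have "(f (p + 2 * h) - 2 * f (p + h) + f p) / h\<^sup>2 = f2 \<eta>"
    using \<open>h > 0\<close> by simp
  moreover have "\<bar>f2 z - f2 \<eta>\<bar> \<le> M * (2 * h)"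
    by (rule lipschitz_within[OF d3 M]) (use z \<xi>(1) \<eta>(1) assms in auto)
  ultimately show ?thesis by simp
qed

lemma central_difference_error:
  fixes k :: "real \<Rightarrow> real"
  assumes k: "\<And>z. z \<in> {a..b} \<Longrightarrow> (k has_real_derivative k1 z) (at z within {a..b})"
    and k1: "\<And>z. z \<in> {a..b} \<Longrightarrow> (k1 has_real_derivative k2 z) (at z within {a..b})"
    and K2: "\<And>z. z \<in> {a..b} \<Longrightarrow> \<bar>k2 z\<bar> \<le> K2" "0 \<le> K2"
    and "h > 0" "a \<le> x - h / 2" "x + h / 2 \<le> b"
  shows "\<bar>k1 x - (k (x + h / 2) - k (x - h / 2)) / h\<bar> \<le> K2 * h"
proof -
  have "x - h / 2 < x + h / 2" "{x - h / 2..x + h / 2} \<subseteq> {a..b}"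
    using assms by auto
  from mvt_within[OF this k] obtain \<xi> where \<xi>: "\<xi> \<in> {x - h / 2<..<x + h / 2}"
    "k (x + h / 2) - k (x - h / 2) = (x + h / 2 - (x - h / 2)) * k1 \<xi>"
    by metis
  have "\<bar>k1 x - k1 \<xi>\<bar> \<le> K2 * h"
    by (rule lipschitz_within[OF k1 K2(1)]) (use \<xi>(1) assms in auto)
  with \<xi>(2) \<open>h > 0\<close> show ?thesis
    by simp
qed

lemma continuous_on_Icc_abs_bound:
  fixes f :: "real \<Rightarrow> real"
  assumes "continuous_on {a..b} f"
  obtains M where "0 \<le> M" "\<And>z. z \<in> {a..b} \<Longrightarrow> \<bar>f z\<bar> \<le> M"
proof -
  have "bounded (f ` {a..b})"
    using assms by (intro compact_imp_bounded compact_continuous_image) auto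
  then obtain M where "M > 0" "\<forall>y\<in>f ` {a..b}. norm y \<le> M"
    by (meson bounded_pos)
  then show ?thesis
    by (intro that[of M]) auto
qed

text \<open>Since only the values on \<open>S\<close> matter, the function itself can serve as its zeroth derivative.\<close>

lemma Ck_on_derivatives:
  assumes "Ck_on k f S"
  obtains D where "D 0 = f"
    and "\<And>j x. j < k \<Longrightarrow> x \<in> S \<Longrightarrow> (D j has_real_derivative D (Suc j) x) (at x within S)"
    and "\<And>j. j \<le> k \<Longrightarrow> continuous_on S (D j)"
proof -
  obtain E where E: "\<forall>x\<in>S. E 0 x = f x"
    "\<forall>j<k. \<forall>x\<in>S. (E j has_real_derivative E (Suc j) x) (at x within S)"
    "\<forall>j\<le>k. continuous_on S (E j)"
    using assms unfolding Ck_on_def by blast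
  define D where "D = E(0 := f)"
  have eq: "D j x = E j x" if "x \<in> S" for j x
    using that E(1) by (simp add: D_def)
  show ?thesis
  proof (rule that[of D])
    show "D 0 = f" by (simp add: D_def)
    show "(D j has_real_derivative D (Suc j) x) (at x within S)" if "j < k" "x \<in> S" for j x
      using has_field_derivative_transform_within[OF E(2)[rule_format, OF that] zero_less_one that(2),
          of "D j"] eq
      by (simp add: D_def)
    show "continuous_on S (D j)" if "j \<le> k" for j
      using E(3) that eq by (subst continuous_on_cong[OF refl]) auto
  qed
qed

section \<open>Consistency of the discrete fractional derivative\<close>

text \<open>The value of the fractional integral of the backward difference \<open>\<delta>u\<close> at the node \<open>a + m * h\<close>, in
  closed form; see \<open>RL_integral_backward_diff\<close>.\<close>

definition RL_difference_sum :: "real \<Rightarrow> real \<Rightarrow> real \<Rightarrow> (real \<Rightarrow> real) \<Rightarrow> nat \<Rightarrow> real" where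
  "RL_difference_sum a h \<beta> u m =
     (\<Sum>j<m. (u (a + real (Suc j) * h) - u (a + real j * h)) * kernel_weight \<beta> h (m - Suc j))"

text \<open>The weights depend only on the distance between the cell and the node. Shifting both by one
  cell therefore matches the sums term by term, so that the increment is the discrete convolution of the
  second differences of \<open>u\<close>, plus one unmatched term from the first cell.\<close>

lemma RL_difference_sum_Suc:
  "RL_difference_sum a h \<beta> u (Suc m) - RL_difference_sum a h \<beta> u m =
     (u (a + h) - u a) * kernel_weight \<beta> h m +
     (\<Sum>j<m. (u (a + real (Suc (Suc j)) * h) - 2 * u (a + real (Suc j) * h) + u (a + real j * h))
        * kernel_weight \<beta> h (m - Suc j))"
proof -
  let ?d = "\<lambda>j. u (a + real (Suc j) * h) - u (a + real j * h)"
  let ?w = "\<lambda>j. kernel_weight \<beta> h (m - Suc j)"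
  have "RL_difference_sum a h \<beta> u (Suc m) = ?d 0 * kernel_weight \<beta> h m + (\<Sum>j<m. ?d (Suc j) * ?w j)"
    unfolding RL_difference_sum_def by (subst sum.lessThan_Suc_shift) simp
  then have "RL_difference_sum a h \<beta> u (Suc m) - RL_difference_sum a h \<beta> u m
      = (u (a + h) - u a) * kernel_weight \<beta> h m + (\<Sum>j<m. ?d (Suc j) * ?w j - ?d j * ?w j)"
    unfolding RL_difference_sum_def sum_subtractf by simp
  also have "(\<Sum>j<m. ?d (Suc j) * ?w j - ?d j * ?w j)
      = (\<Sum>j<m. (u (a + real (Suc (Suc j)) * h) - 2 * u (a + real (Suc j) * h) + u (a + real j * h)) * ?w j)"
    by (intro sum.cong refl) (simp add: left_diff_distrib distrib_right del: of_nat_Suc)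
  finally show ?thesis .
qed

locale C3_function =
  fixes a b :: real and u u1 u2 u3 :: "real \<Rightarrow> real" and \<beta> M2 M3 :: real
  assumes order_pos: "0 < \<beta>"
    and d1: "\<And>z. z \<in> {a..b} \<Longrightarrow> (u has_real_derivative u1 z) (at z within {a..b})"
    and d2: "\<And>z. z \<in> {a..b} \<Longrightarrow> (u1 has_real_derivative u2 z) (at z within {a..b})"
    and d3: "\<And>z. z \<in> {a..b} \<Longrightarrow> (u2 has_real_derivative u3 z) (at z within {a..b})"
    and cont: "continuous_on {a..b} u3"
    and u2_bound: "\<And>z. z \<in> {a..b} \<Longrightarrow> \<bar>u2 z\<bar> \<le> M2" "0 \<le> M2"
    and u3_bound: "\<And>z. z \<in> {a..b} \<Longrightarrow> \<bar>u3 z\<bar> \<le> M3" "0 \<le> M3"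
begin

lemma difference_quotient_error:
  assumes "h > 0" "a \<le> p" "p + h \<le> b" "z \<in> {p..p + h}"
  shows "\<bar>u1 z - (u (p + h) - u p) / h\<bar> \<le> M2 * h"
proof -
  have "p < p + h" "{p..p + h} \<subseteq> {a..b}"
    using assms by auto
  from mvt_within[OF this d1] obtain \<xi> where \<xi>: "\<xi> \<in> {p<..<p + h}" "u (p + h) - u p = (p + h - p) * u1 \<xi>"
    by metis
  have "\<bar>u1 z - u1 \<xi>\<bar> \<le> M2 * h"
    by (rule lipschitz_within[OF d2 u2_bound(1)]) (use \<xi>(1) assms u2_bound in auto)
  with \<xi>(2) \<open>h > 0\<close> show ?thesis
    by simp
qed

lemma cell_subset:
  assumes "h > 0" "j < m"
  shows "{a + real j * h..a + real (Suc j) * h} \<subseteq> {a..a + real m * h}"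
proof -
  have "real (Suc j) * h \<le> real m * h" "0 \<le> real j * h"
    using assms by (auto intro!: mult_right_mono)
  then show ?thesis
    by auto
qed

text \<open>On each cell \<open>\<delta>u / h\<close> is within \<open>M2 * h\<close> of \<open>u'\<close>, so the discrete fractional derivative is
  first-order accurate. By itself this is not enough for the scheme, which divides a difference of two
  such values by \<open>h\<close>.\<close>

lemma RL_difference_sum_error:
  assumes "h > 0" and end_le: "a + real m * h \<le> b"
  shows "\<bar>RL_integral a \<beta> u1 (a + real m * h) - RL_difference_sum a h \<beta> u m / h\<bar>
          \<le> M2 * h * frac_kernel (\<beta> + 1) (real m * h)"
proof -
  have "0 \<le> real m * h" using \<open>h > 0\<close> by simp
  then have "(\<lambda>z. frac_kernel \<beta> (a + real m * h - z) * u1 z) integrable_on {a..a + real m * h}"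
    by (intro RL_integrable[OF order_pos _ d2 DERIV_continuous_on[OF d3]]) (use end_le in auto)
  then have int: "(\<lambda>z. frac_kernel \<beta> (a + real m * h - z) * u1 z)
      integrable_on {a + real j * h..a + real (Suc j) * h}" if "j < m" for j
    by (rule integrable_subinterval_real[OF _ cell_subset[OF \<open>h > 0\<close> that]])
  have "\<bar>u1 z - (u (a + real (Suc j) * h) - u (a + real j * h)) / h\<bar> \<le> M2 * h"
    if "j < m" "z \<in> {a + real j * h<..<a + real (Suc j) * h}" for j z
    using difference_quotient_error[of h "a + real j * h" z] cell_subset[OF \<open>h > 0\<close> that(1)] that(2)
      end_le \<open>h > 0\<close> by (auto simp: algebra_simps)
  from RL_integral_quadrature[OF order_pos \<open>h > 0\<close> int this]
  show ?thesis
    by (simp add: RL_difference_sum_def sum_divide_distrib)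
qed

text \<open>The key estimate: the difference quotients of the discrete fractional derivative are themselves
  first-order accurate. Second difference quotients are within \<open>2 * M3 * h\<close> of \<open>u''\<close>, which handles the
  convolution. The unmatched first cell contributes \<open>\<delta>u\<^sup>1 / h\<^sup>2\<close> times a weight of size \<open>h\<close> away from the
  boundary; it is harmless since \<open>u'(a) = 0\<close> forces \<open>\<delta>u\<^sup>1\<close> to be of order \<open>h\<^sup>2\<close>.\<close>

lemma RL_difference_sum_increment_error:
  assumes "\<beta> < 1" "h > 0" "m > 0" and end_le: "a + real (Suc m) * h \<le> b" and slope: "u1 a = 0"
  shows "\<bar>RL_integral a \<beta> u2 (a + real m * h)
            - (RL_difference_sum a h \<beta> u (Suc m) - RL_difference_sum a h \<beta> u m) / h\<^sup>2\<bar>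
          \<le> M3 * (2 * h) * frac_kernel (\<beta> + 1) (real m * h) + M2 * h * frac_kernel \<beta> (real m * h)"
proof -
  define c where
    "c j = (u (a + real (Suc (Suc j)) * h) - 2 * u (a + real (Suc j) * h) + u (a + real j * h)) / h\<^sup>2" for j
  have mh: "0 \<le> real m * h" "a + real m * h \<le> b"
    using \<open>h > 0\<close> end_le by (auto simp: algebra_simps)
  have "(\<lambda>z. frac_kernel \<beta> (a + real m * h - z) * u2 z) integrable_on {a..a + real m * h}"
    by (intro RL_integrable[OF order_pos _ d3 cont]) (use mh in auto)
  then have int: "(\<lambda>z. frac_kernel \<beta> (a + real m * h - z) * u2 z)
      integrable_on {a + real j * h..a + real (Suc j) * h}" if "j < m" for j
    by (rule integrable_subinterval_real[OF _ cell_subset[OF \<open>h > 0\<close> that]])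
  have "\<bar>u2 z - c j\<bar> \<le> M3 * (2 * h)"
    if "j < m" "z \<in> {a + real j * h<..<a + real (Suc j) * h}" for j z
  proof -
    let ?p = "a + real j * h"
    have "real (Suc (Suc j)) * h \<le> real (Suc m) * h" "0 \<le> real j * h"
      using \<open>j < m\<close> \<open>h > 0\<close> by (auto intro!: mult_right_mono)
    then have "a \<le> ?p" "?p + 2 * h \<le> b"
      using end_le by (auto simp: algebra_simps)
    moreover have "c j = (u (?p + 2 * h) - 2 * u (?p + h) + u ?p) / h\<^sup>2"
      by (simp add: c_def algebra_simps)
    ultimately show ?thesis
      using second_difference_bound[OF d1 d2 d3 u3_bound \<open>h > 0\<close>, of ?p z] that(2)
      by (simp add: algebra_simps)
  qed
  note quad = RL_integral_quadrature[where c = c, OF order_pos \<open>h > 0\<close> int this]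
  have "\<bar>(u (a + h) - u a) / h\<bar> \<le> M2 * h"
  proof -
    have "h \<le> real (Suc m) * h"
      using \<open>h > 0\<close> by simp
    then have "a + h \<le> b"
      using end_le by linarith
    then show ?thesis
      using difference_quotient_error[of h a a] \<open>h > 0\<close> slope by simp
  qed
  then have "\<bar>(u (a + h) - u a) / h * (kernel_weight \<beta> h m / h)\<bar> \<le> (M2 * h) * frac_kernel \<beta> (real m * h)"
    using kernel_weight_le[OF order_pos \<open>\<beta> < 1\<close> \<open>h > 0\<close> \<open>m > 0\<close>] \<open>h > 0\<close> u2_bound(2)
    unfolding abs_mult by (intro mult_mono) (auto simp: field_simps)
  moreover have "(RL_difference_sum a h \<beta> u (Suc m) - RL_difference_sum a h \<beta> u m) / h\<^sup>2
      = (u (a + h) - u a) / h * (kernel_weight \<beta> h m / h) + (\<Sum>j<m. c j * kernel_weight \<beta> h (m - Suc j))"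
    unfolding RL_difference_sum_Suc c_def
    by (simp add: add_divide_distrib[of "(u (a + h) - u a) * kernel_weight \<beta> h m"]
        sum_divide_distrib power2_eq_square)
  ultimately show ?thesis
    using quad by linarith
qed

lemma RL_integral_bounds:
  assumes "x \<in> {a..b}" "\<And>z. z \<in> {a..b} \<Longrightarrow> \<bar>u1 z\<bar> \<le> M1" "0 \<le> M1"
  shows "\<bar>RL_integral a \<beta> u1 x\<bar> \<le> M1 * frac_kernel (\<beta> + 1) (b - a)"
    and "\<bar>RL_integral a \<beta> u2 x\<bar> \<le> M2 * frac_kernel (\<beta> + 1) (b - a)"
proof -
  have mono: "frac_kernel (\<beta> + 1) (x - a) \<le> frac_kernel (\<beta> + 1) (b - a)"
    using assms(1) by (intro frac_kernel_mono[OF order_pos]) auto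
  have "\<bar>RL_integral a \<beta> u1 x\<bar> \<le> M1 * frac_kernel (\<beta> + 1) (x - a)"
    using assms by (intro RL_integral_abs_le order_pos RL_integrable[OF order_pos _ d2 DERIV_continuous_on[OF d3]]) auto
  also have "\<dots> \<le> M1 * frac_kernel (\<beta> + 1) (b - a)"
    by (rule mult_left_mono[OF mono assms(3)])
  finally show "\<bar>RL_integral a \<beta> u1 x\<bar> \<le> M1 * frac_kernel (\<beta> + 1) (b - a)" .
  have "\<bar>RL_integral a \<beta> u2 x\<bar> \<le> M2 * frac_kernel (\<beta> + 1) (x - a)"
    using assms u2_bound by (intro RL_integral_abs_le order_pos RL_integrable[OF order_pos _ d3 cont]) auto
  also have "\<dots> \<le> M2 * frac_kernel (\<beta> + 1) (b - a)"
    by (rule mult_left_mono[OF mono u2_bound(2)])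
  finally show "\<bar>RL_integral a \<beta> u2 x\<bar> \<le> M2 * frac_kernel (\<beta> + 1) (b - a)" .
qed

section \<open>The flux and its slope at the left boundary\<close>

lemma RL_derivative_eq:
  assumes "u a = 0" "x \<in> {a<..<b}"
  shows "RL_derivative a (1 - \<beta>) u x = RL_integral a \<beta> u1 x"
  using RL_integral_has_derivative[OF order_pos assms(2) d1 d2 DERIV_continuous_on[OF d3]] assms(1)
  by (simp add: RL_derivative_def DERIV_imp_deriv)

lemma flux_has_derivative:
  assumes "u a = 0" and x: "x \<in> {a<..<b}"
    and k: "\<And>z. z \<in> {a..b} \<Longrightarrow> (k has_real_derivative k1 z) (at z within {a..b})"
  shows "((\<lambda>y. k y * RL_derivative a (1 - \<beta>) u y) has_real_derivative
           k1 x * RL_integral a \<beta> u1 x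
           + k x * (frac_kernel \<beta> (x - a) * u1 a + RL_integral a \<beta> u2 x)) (at x)"
proof -
  have "(k has_real_derivative k1 x) (at x)"
    using k[of x] x at_within_Icc_at[of a x b] by simp
  from DERIV_mult[OF this RL_integral_has_derivative[OF order_pos x d2 d3 cont]]
  have "((\<lambda>y. k y * RL_integral a \<beta> u1 y) has_real_derivative
           k1 x * RL_integral a \<beta> u1 x
           + k x * (frac_kernel \<beta> (x - a) * u1 a + RL_integral a \<beta> u2 x)) (at x)"
    by (simp add: algebra_simps)
  then show ?thesis
    by (rule has_field_derivative_transform_within_open[of _ _ _ "{a<..<b}"])
      (use x RL_derivative_eq[OF assms(1)] in auto)
qed

text \<open>The equation itself regularises \<open>u\<close> at the left end. In the expanded derivative of the flux every
  term is bounded near \<open>a\<close> except \<open>k x * frac_kernel \<beta> (x - a) * u'(a)\<close>, and \<open>k\<close> is bounded away from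
  zero. As the source term \<open>f\<close> is bounded, \<open>u'(a)\<close> has to vanish.\<close>

lemma initial_slope_zero:
  assumes "a < b" "\<beta> < 1" "u a = 0"
    and k: "\<And>z. z \<in> {a..b} \<Longrightarrow> (k has_real_derivative k1 z) (at z within {a..b})"
    and K1: "\<And>z. z \<in> {a..b} \<Longrightarrow> \<bar>k1 z\<bar> \<le> K1"
    and c: "0 < c0" "\<And>x. x \<in> {a<..<b} \<Longrightarrow> c0 \<le> k x \<and> k x \<le> c1"
    and flux: "\<And>x. x \<in> {a<..<b} \<Longrightarrow>
       ((\<lambda>y. k y * RL_derivative a (1 - \<beta>) u y) has_real_derivative - f x) (at x)"
    and F: "\<And>x. x \<in> {a..b} \<Longrightarrow> \<bar>f x\<bar> \<le> F"
  shows "u1 a = 0"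
proof -
  define Kb where "Kb = frac_kernel (\<beta> + 1) (b - a)"
  obtain M1 where M1: "0 \<le> M1" "\<And>z. z \<in> {a..b} \<Longrightarrow> \<bar>u1 z\<bar> \<le> M1"
    using continuous_on_Icc_abs_bound[OF DERIV_continuous_on[OF d2]] by metis
  show ?thesis
  proof (rule frac_kernel_unbounded[OF order_pos \<open>\<beta> < 1\<close>, of "b - a"])
    fix t assume t: "0 < t" "t < b - a"
    define x where "x = a + t"
    have x: "x \<in> {a<..<b}" "x \<in> {a..b}"
      using t by (auto simp: x_def)
    note bnd = RL_integral_bounds[OF x(2) M1(2,1), folded Kb_def]
    have kx: "c0 \<le> k x" "k x \<le> c1"
      using c(2)[OF x(1)] by auto
    have "- f x = k1 x * RL_integral a \<beta> u1 x
        + k x * (frac_kernel \<beta> t * u1 a + RL_integral a \<beta> u2 x)"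
      using DERIV_unique[OF flux[OF x(1)] flux_has_derivative[OF \<open>u a = 0\<close> x(1) k]] by (simp add: x_def)
    then have "k x * frac_kernel \<beta> t * u1 a
        = - f x - k1 x * RL_integral a \<beta> u1 x - k x * RL_integral a \<beta> u2 x"
      by (simp add: algebra_simps)
    then have "\<bar>k x * frac_kernel \<beta> t * u1 a\<bar>
        \<le> \<bar>f x\<bar> + \<bar>k1 x * RL_integral a \<beta> u1 x\<bar> + \<bar>k x * RL_integral a \<beta> u2 x\<bar>"
      by linarith
    also have "\<bar>k1 x * RL_integral a \<beta> u1 x\<bar> \<le> K1 * (M1 * Kb)"
      unfolding abs_mult using K1[OF x(2)] bnd(1) by (intro mult_mono) auto
    also have "\<bar>k x * RL_integral a \<beta> u2 x\<bar> \<le> c1 * (M2 * Kb)"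
      unfolding abs_mult using kx \<open>0 < c0\<close> bnd(2) by (intro mult_mono) auto
    also have "\<bar>f x\<bar> \<le> F"
      by (rule F[OF x(2)])
    finally have "k x * frac_kernel \<beta> t * \<bar>u1 a\<bar> \<le> F + K1 * (M1 * Kb) + c1 * (M2 * Kb)"
      using kx \<open>0 < c0\<close> frac_kernel_nonneg[OF order_pos, of t] by (simp add: abs_mult)
    moreover have "c0 * (\<bar>u1 a\<bar> * frac_kernel \<beta> t) \<le> k x * (\<bar>u1 a\<bar> * frac_kernel \<beta> t)"
      using kx frac_kernel_nonneg[OF order_pos, of t] by (intro mult_right_mono) auto
    ultimately show "\<bar>u1 a\<bar> * frac_kernel \<beta> t \<le> (F + K1 * (M1 * Kb) + c1 * (M2 * Kb)) / c0"
      using \<open>0 < c0\<close> by (simp add: field_simps)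
  qed (use \<open>a < b\<close> in auto)
qed

end

section \<open>The truncation error\<close>

text \<open>The discrete product rule. Here \<open>g\<close> and \<open>g1\<close> stand for the fractional derivative and its derivative
  at the node, \<open>kp\<close>, \<open>km\<close> for the coefficient at the two midpoints and \<open>S / h\<close>, \<open>Sp / h\<close> for the
  discrete fractional derivative. Each summand has a factor that is of order \<open>h\<close>, up to the boundary
  singularity in the second one.\<close>

lemma flux_difference_decomposition:
  fixes h :: real
  assumes "h \<noteq> 0"
  shows "(k1 * g + k * g1) - 1 / h\<^sup>2 * (kp * Sp - km * S)
    = (k - kp) * g1 + kp * (g1 - (Sp - S) / h\<^sup>2)
      + (k1 - (kp - km) / h) * g + (kp - km) / h * (g - S / h)"
  using assms by (simp add: field_simps power2_eq_square)

theorem theorem1: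
  fixes \<alpha> a b c0 c1 :: real and \<kappa> u f :: "real \<Rightarrow> real"
  assumes "0 < \<alpha>" and "\<alpha> < 1" and "a < b"
    and "0 < c0" and "0 < c1"
    and "\<And>x. x \<in> {a<..<b} \<Longrightarrow> c0 \<le> \<kappa> x \<and> \<kappa> x \<le> c1"
    and "\<And>x. x \<in> {a<..<b} \<Longrightarrow>
           ((\<lambda>y. \<kappa> y * RL_derivative a \<alpha> u y) has_real_derivative - f x) (at x)"
    and "u a = 0" and "u b = 0"
    and "Ck_on 1 f {a..b}" and "Ck_on 2 \<kappa> {a..b}" and "Ck_on 3 u {a..b}"
  shows "\<exists>C. \<forall>P\<ge>2. \<forall>n\<in>{1..P - 1}.
           \<bar>truncation_error \<alpha> a b \<kappa> u P n\<bar>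
             \<le> C * mesh_size a b P * (1 + (mesh_node a b P n - a) powr (- \<alpha>))"
proof -
  define \<beta> where "\<beta> = 1 - \<alpha>"
  have \<beta>: "0 < \<beta>" "\<beta> < 1" "1 - \<beta> = \<alpha>"
    using assms(1,2) by (auto simp: \<beta>_def)
  obtain U where U: "U 0 = u"
    "\<And>j x. j < 3 \<Longrightarrow> x \<in> {a..b} \<Longrightarrow> (U j has_real_derivative U (Suc j) x) (at x within {a..b})"
    "\<And>j. j \<le> 3 \<Longrightarrow> continuous_on {a..b} (U j)"
    using Ck_on_derivatives[OF assms(12)] by metis
  define u1 u2 u3 where u_defs: "u1 = U 1" "u2 = U 2" "u3 = U 3"
  obtain D where D: "D 0 = \<kappa>"
    "\<And>j x. j < 2 \<Longrightarrow> x \<in> {a..b} \<Longrightarrow> (D j has_real_derivative D (Suc j) x) (at x within {a..b})"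
    "\<And>j. j \<le> 2 \<Longrightarrow> continuous_on {a..b} (D j)"
    using Ck_on_derivatives[OF assms(11)] by metis
  define k1 k2 where k_defs: "k1 = D 1" "k2 = D 2"
  have cf: "continuous_on {a..b} f"
    by (rule Ck_on_derivatives[OF assms(10)]) (metis le0)
  have du: "(u has_real_derivative u1 z) (at z within {a..b})"
    "(u1 has_real_derivative u2 z) (at z within {a..b})"
    "(u2 has_real_derivative u3 z) (at z within {a..b})"
    and dk: "(\<kappa> has_real_derivative k1 z) (at z within {a..b})"
    "(k1 has_real_derivative k2 z) (at z within {a..b})" if "z \<in> {a..b}" for z
    using U(2)[of 0 z] U(2)[of 1 z] U(2)[of 2 z] D(2)[of 0 z] D(2)[of 1 z] that
    by (simp_all add: u_defs k_defs U(1) D(1) numeral_2_eq_2 numeral_3_eq_3)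
  have cu: "continuous_on {a..b} u1" "continuous_on {a..b} u2" "continuous_on {a..b} u3"
    and ck: "continuous_on {a..b} k1" "continuous_on {a..b} k2"
    using U(3) D(3) by (simp_all add: u_defs k_defs)
  obtain M1 where M1: "0 \<le> M1" "\<And>z. z \<in> {a..b} \<Longrightarrow> \<bar>u1 z\<bar> \<le> M1"
    using continuous_on_Icc_abs_bound[OF cu(1)] by metis
  obtain M2 where M2: "0 \<le> M2" "\<And>z. z \<in> {a..b} \<Longrightarrow> \<bar>u2 z\<bar> \<le> M2"
    using continuous_on_Icc_abs_bound[OF cu(2)] by metis
  obtain M3 where M3: "0 \<le> M3" "\<And>z. z \<in> {a..b} \<Longrightarrow> \<bar>u3 z\<bar> \<le> M3"
    using continuous_on_Icc_abs_bound[OF cu(3)] by metis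
  obtain K1 where K1: "0 \<le> K1" "\<And>z. z \<in> {a..b} \<Longrightarrow> \<bar>k1 z\<bar> \<le> K1"
    using continuous_on_Icc_abs_bound[OF ck(1)] by metis
  obtain K2 where K2: "0 \<le> K2" "\<And>z. z \<in> {a..b} \<Longrightarrow> \<bar>k2 z\<bar> \<le> K2"
    using continuous_on_Icc_abs_bound[OF ck(2)] by metis
  obtain F where F: "\<And>z. z \<in> {a..b} \<Longrightarrow> \<bar>f z\<bar> \<le> F"
    using continuous_on_Icc_abs_bound[OF cf] by metis
  interpret C3_function a b u u1 u2 u3 \<beta> M2 M3
    by unfold_locales (use \<beta>(1) du cu(3) M2 M3 in auto)
  have slope: "u1 a = 0"
    by (rule initial_slope_zero[OF \<open>a < b\<close> \<beta>(2) \<open>u a = 0\<close> dk(1) K1(2) \<open>0 < c0\<close> assms(6)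
          assms(7)[folded \<beta>(3)] F])
  define Kb where "Kb = frac_kernel (\<beta> + 1) (b - a)"
  have Kb: "0 \<le> Kb"
    unfolding Kb_def using \<beta> by (intro frac_kernel_nonneg) auto
  \<comment> \<open>The product \<open>K1 * M2 * Kb\<close> arises twice, from the shift of \<open>\<kappa>\<close> by \<open>h / 2\<close> and from the error of
    \<open>S n / h\<close>; \<open>K2\<close> comes from the central difference of \<open>\<kappa>\<close>. The terms with \<open>c1\<close> stem from the increment
    of \<open>S\<close>, the last of them being the coefficient of the singular factor.\<close>
  define C where "C = 2 * (K1 * M2 * Kb) + 2 * (c1 * M3 * Kb) + K2 * M1 * Kb + c1 * M2 / Gamma \<beta>"
  show ?thesis
  proof (intro exI[of _ C] allI impI ballI)
    fix P n :: nat
    assume "2 \<le> P" "n \<in> {1..P - 1}"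
    then have nP: "0 < n" "Suc n \<le> P" "n \<le> P" "0 < P"
      by auto
    define h where "h = mesh_size a b P"
    define x where "x = a + real n * h"
    define S where "S = RL_difference_sum a h \<beta> u"
    define g g1 where "g = RL_integral a \<beta> u1 x" and "g1 = RL_integral a \<beta> u2 x"
    define kp km where "kp = \<kappa> (x + h / 2)" and "km = \<kappa> (x - h / 2)"
    define s where "s = (x - a) powr (- \<alpha>)"
    have h: "0 < h"
      using \<open>a < b\<close> nP by (simp add: h_def mesh_size_def)
    have "real (Suc n) * h \<le> real P * h" "1 * h \<le> real n * h"
      using nP h by (auto intro!: mult_right_mono simp del: of_nat_Suc)
    moreover have "real P * h = b - a"
      using nP by (simp add: h_def mesh_size_def)
    ultimately have end_le: "a + real (Suc n) * h \<le> b" and x_bounds: "a + h \<le> x" "x + h \<le> b"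
      by (auto simp: x_def algebra_simps)
    then have x: "x \<in> {a<..<b}" "x \<in> {a..b}" "a + real n * h \<le> b"
      using h by (auto simp: x_def)
    have mid: "mesh_mid a b P n = x + h / 2" "mesh_mid a b P (n - 1) = x - h / 2"
      using nP by (auto simp: mesh_mid_def mesh_node_def midpoint_def x_def field_simps
          of_nat_diff simp flip: h_def)
    have node: "mesh_node a b P n = x"
      by (simp add: mesh_node_def x_def h_def)
    have int: "RL_integral a \<beta> (backward_diff a b P u) (mesh_node a b P m) = S m" if "m \<le> P" for m
      using RL_integral_backward_diff[OF \<beta>(1) \<open>a < b\<close> \<open>0 < P\<close> that]
      by (simp add: S_def RL_difference_sum_def mesh_node_def h_def)
    have "deriv (\<lambda>y. \<kappa> y * RL_derivative a \<alpha> u y) x = k1 x * g + \<kappa> x * g1"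
      using DERIV_imp_deriv[OF flux_has_derivative[OF \<open>u a = 0\<close> x(1) dk(1)]]
      by (simp add: \<beta>(3) slope g_def g1_def)
    then have "truncation_error \<alpha> a b \<kappa> u P n
        = (k1 x * g + \<kappa> x * g1) - 1 / h\<^sup>2 * (kp * S (Suc n) - km * S n)"
      using int[of "Suc n"] int[of n] nP
      by (simp add: truncation_error_def mid(1) mid(2)[simplified] node kp_def km_def flip: \<beta>_def h_def)
    also have "(k1 x * g + \<kappa> x * g1) - 1 / h\<^sup>2 * (kp * S (Suc n) - km * S n)
      = (\<kappa> x - kp) * g1 + kp * (g1 - (S (Suc n) - S n) / h\<^sup>2)
        + (k1 x - (kp - km) / h) * g + (kp - km) / h * (g - S n / h)"
      using h by (intro flux_difference_decomposition) simp
    finally have "truncation_error \<alpha> a b \<kappa> u P n =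
        (\<kappa> x - kp) * g1 + kp * (g1 - (S (Suc n) - S n) / h\<^sup>2)
        + (k1 x - (kp - km) / h) * g + (kp - km) / h * (g - S n / h)" .
    moreover have triangle: "\<bar>p + q + r + t\<bar> \<le> \<bar>p\<bar> + \<bar>q\<bar> + \<bar>r\<bar> + \<bar>t\<bar>" for p q r t :: real
      by linarith
    ultimately have "\<bar>truncation_error \<alpha> a b \<kappa> u P n\<bar>
        \<le> \<bar>\<kappa> x - kp\<bar> * \<bar>g1\<bar> + \<bar>kp\<bar> * \<bar>g1 - (S (Suc n) - S n) / h\<^sup>2\<bar>
          + \<bar>k1 x - (kp - km) / h\<bar> * \<bar>g\<bar> + \<bar>(kp - km) / h\<bar> * \<bar>g - S n / h\<bar>"
      unfolding abs_mult[symmetric] by (simp only: triangle)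
    also have "\<dots> \<le> K1 * h * (M2 * Kb) + c1 * (M3 * (2 * h) * Kb + M2 * h * (s / Gamma \<beta>))
          + K2 * h * (M1 * Kb) + K1 * (M2 * h * Kb)"
    proof (intro add_mono mult_mono)
      have Kx: "frac_kernel (\<beta> + 1) (real n * h) \<le> Kb"
        unfolding Kb_def using x h by (intro frac_kernel_mono \<beta>) (auto simp: x_def)
      have "frac_kernel \<beta> (real n * h) = s / Gamma \<beta>"
        by (simp add: frac_kernel_def s_def x_def \<beta>_def)
      note incr = RL_difference_sum_increment_error[OF \<beta>(2) h \<open>0 < n\<close> end_le slope, unfolded this]
      have "M3 * (2 * h) * frac_kernel (\<beta> + 1) (real n * h) \<le> M3 * (2 * h) * Kb"
        using Kx M3(1) h by (intro mult_left_mono) auto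
      with incr show "\<bar>g1 - (S (Suc n) - S n) / h\<^sup>2\<bar> \<le> M3 * (2 * h) * Kb + M2 * h * (s / Gamma \<beta>)"
        unfolding S_def g1_def x_def by linarith
      have "M2 * h * frac_kernel (\<beta> + 1) (real n * h) \<le> M2 * h * Kb"
        using Kx M2(1) h by (intro mult_left_mono) auto
      with RL_difference_sum_error[OF h x(3)] show "\<bar>g - S n / h\<bar> \<le> M2 * h * Kb"
        unfolding S_def g_def x_def by linarith
      show "\<bar>\<kappa> x - kp\<bar> \<le> K1 * h"
        unfolding kp_def by (rule lipschitz_within[OF dk(1) K1(2)]) (use x x_bounds h K1 in auto)
      have "\<bar>kp - km\<bar> \<le> K1 * h"
        unfolding kp_def km_def
        by (rule lipschitz_within[OF dk(1) K1(2)]) (use x x_bounds h K1 in auto)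
      then show "\<bar>(kp - km) / h\<bar> \<le> K1"
        using h by (simp add: field_simps)
      show "\<bar>k1 x - (kp - km) / h\<bar> \<le> K2 * h"
        unfolding kp_def km_def
        by (rule central_difference_error[OF dk K2(2) K2(1) h]) (use x_bounds h in auto)
      have "c0 \<le> kp \<and> kp \<le> c1"
        unfolding kp_def using x_bounds h by (intro assms(6)) auto
      then show "\<bar>kp\<bar> \<le> c1"
        using \<open>0 < c0\<close> by linarith
      show "\<bar>g\<bar> \<le> M1 * Kb" "\<bar>g1\<bar> \<le> M2 * Kb"
        using RL_integral_bounds[OF x(2) M1(2,1)] by (simp_all add: g_def g1_def Kb_def)
    qed (use h K1 K2 \<open>0 < c1\<close> in auto)
    also have "\<dots> = (2 * (K1 * M2 * Kb) + 2 * (c1 * M3 * Kb) + K2 * M1 * Kb) * h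
          + c1 * M2 / Gamma \<beta> * h * s"
      by (simp add: algebra_simps)
    also have "\<dots> \<le> C * h * (1 + s)"
    proof -
      have nonneg: "0 \<le> 2 * (K1 * M2 * Kb) + 2 * (c1 * M3 * Kb) + K2 * M1 * Kb" "0 \<le> c1 * M2 / Gamma \<beta>"
        "0 \<le> s"
        using K1 K2 M1 M2 M3 Kb \<open>0 < c1\<close> Gamma_real_pos[OF \<beta>(1)] by (auto simp: s_def)
      have "C * h * (1 + s) = (2 * (K1 * M2 * Kb) + 2 * (c1 * M3 * Kb) + K2 * M1 * Kb) * h
          + c1 * M2 / Gamma \<beta> * h * s
          + ((2 * (K1 * M2 * Kb) + 2 * (c1 * M3 * Kb) + K2 * M1 * Kb) * (h * s) + c1 * M2 / Gamma \<beta> * h)"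
        unfolding C_def by (simp add: algebra_simps add_divide_distrib)
      moreover have "0 \<le> (2 * (K1 * M2 * Kb) + 2 * (c1 * M3 * Kb) + K2 * M1 * Kb) * (h * s)
          + c1 * M2 / Gamma \<beta> * h"
        by (intro add_nonneg_nonneg mult_nonneg_nonneg[OF nonneg(1)] mult_nonneg_nonneg[OF nonneg(2)])
          (use h nonneg(3) in auto)
      ultimately show ?thesis by linarith
    qed
    finally show "\<bar>truncation_error \<alpha> a b \<kappa> u P n\<bar>
        \<le> C * mesh_size a b P * (1 + (mesh_node a b P n - a) powr (- \<alpha>))"
      by (simp add: s_def node flip: h_def)
  qed
qed

end
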